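(* Let $\gamma : I\to\mathbb{R}^3$ be a smooth curve on an open interval $I$ parametrized by arc length $s$, with nowhere vanishing curvature and unit tangent $T$. Let $c$ be a real constant with $c-s>0$ for all $s\in I$, and let $\widetilde\gamma=\gamma+(c-s)T$ be the involute of $\gamma$. Assume that $\widetilde\gamma$ has nowhere zero torsion. Then the binormal indicatrix of $\widetilde\gamma$ is a circle on the unit sphere if and only if $\widetilde\gamma$ is a generalized helix.
   Context: The binormal indicatrix of $\widetilde\gamma$ is the curve traced on the unit sphere by its unit binormal vector $\widetilde B$. "Is a circle on the unit sphere" means that the indicatrix lies on (is an arc of) the intersection of the unit sphere with a plane. A curve with curvature $k>0$ and torsion $t$ is a generalized helix if $t/k$ is constant. *)

theory Defs
  imports "HOL-Analysis.Analysis"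
begin

text \<open>
  The Frenet apparatus below is that of a parametrized curve of arbitrary (nonzero) speed:
  derivatives of the frame with respect to arc length are derivatives with respect to the
  parameter divided by the speed. At singular points, and at points of zero curvature, the
  values are those given by the convention \<open>x / 0 = 0\<close> and carry no meaning.
\<close>

definition velocity :: "(real \<Rightarrow> real^3) \<Rightarrow> real \<Rightarrow> real^3" where
  "velocity f = (\<lambda>s. vector_derivative f (at s))"

definition speed :: "(real \<Rightarrow> real^3) \<Rightarrow> real \<Rightarrow> real" where
  "speed f s = norm (velocity f s)"

text \<open>All iterated derivatives exist on \<open>I\<close>; meant for open \<open>I\<close>, since the derivatives are
  two-sided.\<close>

definition smooth_curve_on :: "real set \<Rightarrow> (real \<Rightarrow> real^3) \<Rightarrow> bool" where
  "smooth_curve_on I f \<longleftrightarrow> (\<forall>n. \<forall>s\<in>I. (velocity ^^ n) f differentiable (at s))"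

definition unit_tangent :: "(real \<Rightarrow> real^3) \<Rightarrow> real \<Rightarrow> real^3" where
  "unit_tangent f s = velocity f s /\<^sub>R speed f s"

definition curvature :: "(real \<Rightarrow> real^3) \<Rightarrow> real \<Rightarrow> real" where
  "curvature f s = norm (velocity (unit_tangent f) s) / speed f s"

definition unit_normal :: "(real \<Rightarrow> real^3) \<Rightarrow> real \<Rightarrow> real^3" where
  "unit_normal f s = velocity (unit_tangent f) s /\<^sub>R norm (velocity (unit_tangent f) s)"

definition unit_binormal :: "(real \<Rightarrow> real^3) \<Rightarrow> real \<Rightarrow> real^3" where
  "unit_binormal f s = cross3 (unit_tangent f s) (unit_normal f s)"

text \<open>Sign convention: \<open>dB/ds = - t N\<close> with respect to arc length.\<close>

definition torsion :: "(real \<Rightarrow> real^3) \<Rightarrow> real \<Rightarrow> real" where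
  "torsion f s = - (velocity (unit_binormal f) s \<bullet> unit_normal f s) / speed f s"

text \<open>For \<open>f\<close> parametrized by arc length.\<close>

definition involute :: "real \<Rightarrow> (real \<Rightarrow> real^3) \<Rightarrow> real \<Rightarrow> real^3" where
  "involute c f s = f s + (c - s) *\<^sub>R unit_tangent f s"

definition generalized_helix_on :: "real set \<Rightarrow> (real \<Rightarrow> real^3) \<Rightarrow> bool" where
  "generalized_helix_on I f \<longleftrightarrow>
     (\<forall>s\<in>I. curvature f s > 0) \<and> (\<lambda>s. torsion f s / curvature f s) constant_on I"

text \<open>The trace of \<open>f\<close> over \<open>I\<close> lies on the intersection of the unit sphere with a plane.\<close>

definition circle_on_unit_sphere :: "real set \<Rightarrow> (real \<Rightarrow> real^3) \<Rightarrow> bool" where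
  "circle_on_unit_sphere I f \<longleftrightarrow>
     (\<exists>n d. n \<noteq> 0 \<and> f ` I \<subseteq> sphere 0 1 \<inter> {x. n \<bullet> x = d})"

end

theory Submission
  imports Defs
begin

text \<open>
  The equivalence holds for every curve that satisfies the Frenet equations and has nowhere zero
  torsion, and the involute is such a curve.

  Write \<open>T, N, B\<close> for the frame, \<open>v\<close> for the speed, \<open>k\<close> for the curvature and \<open>t\<close> for the
  torsion, so that \<open>T' = v k N\<close>, \<open>N' = v (t B - k T)\<close> and \<open>B' = - v t N\<close>.
  Suppose that \<open>B\<close> stays in the plane \<open>n \<bullet> x = d\<close>. Differentiating gives \<open>v t (n \<bullet> N) = 0\<close>, hence
  \<open>n \<bullet> N = 0\<close> as the torsion does not vanish. Therefore \<open>n \<bullet> T\<close> has derivative zero and is a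
  constant \<open>a\<close>, and differentiating \<open>n \<bullet> N = 0\<close> gives \<open>t d = k a\<close>. If \<open>d\<close> were zero, so would be
  \<open>a\<close>, and \<open>n\<close> would be orthogonal to the whole frame; so \<open>t / k = a / d\<close>
  (\<open>helix_if_binormal_circle\<close>). Conversely, if \<open>t = m k\<close>, then \<open>m T + B\<close> has derivative
  \<open>v (m k - t) N = 0\<close>; it is a fixed vector \<open>n\<close> with \<open>n \<bullet> B = 1\<close>
  (\<open>binormal_circle_if_helix\<close>).

  The involute of a unit speed curve \<open>\<gamma>\<close> has the velocity \<open>(c - s) \<gamma>''\<close>, so it inherits the
  smoothness of \<open>\<gamma>\<close>, and its curvature vanishes nowhere because its torsion does not
  (\<open>involute_frenet_curve\<close>).
\<close>

section \<open>Derivatives of curves\<close>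

lemma has_vector_derivative_velocity:
  "f differentiable (at s) \<Longrightarrow> (f has_vector_derivative velocity f s) (at s)"
  by (simp add: velocity_def vector_derivative_works)

lemma velocity_eqI:
  "(f has_vector_derivative D) (at s) \<Longrightarrow> velocity f s = D"
  by (simp add: velocity_def vector_derivative_at)

lemma differentiable_cong_open:
  fixes f g :: "real \<Rightarrow> 'a::real_normed_vector"
  assumes "open I" "s \<in> I" "\<And>x. x \<in> I \<Longrightarrow> f x = g x" "g differentiable (at s)"
  shows "f differentiable (at s)"
  using has_vector_derivative_transform_within_open[OF _ assms(1,2), of g _ f] assms(3,4)
  by (metis differentiableI_vector vector_derivative_works)

lemma has_real_derivative_inner:
  assumes "(f has_vector_derivative f') (at s)" "(g has_vector_derivative g') (at s)"
  shows "((\<lambda>x. f x \<bullet> g x) has_real_derivative (f s \<bullet> g' + f' \<bullet> g s)) (at s)"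
  using bounded_bilinear.has_vector_derivative[OF bounded_bilinear_inner assms]
  by (simp add: has_real_derivative_iff_has_vector_derivative)

lemma has_real_derivative_norm:
  fixes v :: "real \<Rightarrow> 'a::real_inner"
  assumes "(v has_vector_derivative w) (at s)" "v s \<noteq> 0"
  shows "((\<lambda>x. norm (v x)) has_real_derivative (v s \<bullet> w) / norm (v s)) (at s)"
  using has_real_derivative_inner[OF assms(1,1)] assms(2)
  unfolding norm_eq_sqrt_inner
  by (auto intro!: derivative_eq_intros simp: inner_commute field_simps leD[OF inner_ge_zero])

lemma bounded_bilinear_cross3: "bounded_bilinear cross3"
  using bilinear_cross bilinear_conv_bounded_bilinear by blast

lemma constant_on_if_derivative_zero:
  fixes f :: "real \<Rightarrow> 'a::real_normed_vector"
  assumes "is_interval I" "\<And>s. s \<in> I \<Longrightarrow> (f has_vector_derivative 0) (at s)"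
  shows "f constant_on I"
proof -
  have "convex I" using assms(1) is_interval_convex by blast
  then obtain c where "\<And>s. s \<in> I \<Longrightarrow> f s = c"
    using has_vector_derivative_zero_constant has_vector_derivative_at_within[OF assms(2)] by metis
  then show ?thesis unfolding constant_on_def by blast
qed

section \<open>Orthonormal frames\<close>

lemma orthonormal_cross:
  assumes "T \<bullet> T = 1" "N \<bullet> N = 1" "T \<bullet> N = 0"
  shows "cross3 (cross3 T N) T = N" "cross3 N T = - cross3 T N" "cross3 (cross3 T N) N = - T"
  using assms cross_skew[of "cross3 T N" T] cross_skew[of "cross3 T N" N] cross_skew[of N T]
  by (simp_all add: Lagrange inner_commute)

text \<open>Cancelling two directions of the frame by products alone: \<open>N = (T \<times> N) \<times> T\<close> is a product of
  two vectors orthogonal to \<open>x\<close>, so \<open>x \<times> N = 0\<close> by Lagrange's identity.\<close>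

lemma orthogonal_to_frame_parallel:
  assumes "x \<bullet> T = 0" "x \<bullet> cross3 T N = 0" "T \<bullet> T = 1" "N \<bullet> N = 1" "T \<bullet> N = 0"
  shows "x = (x \<bullet> N) *\<^sub>R N"
proof -
  have "cross3 x (cross3 (cross3 T N) T) = 0" using assms(1,2) by (simp add: Lagrange)
  then have "cross3 x N = 0" by (simp add: orthonormal_cross(1)[OF assms(3-5)])
  then have "cross3 N (cross3 x N) = 0" by simp
  then show ?thesis using assms(4) by (simp add: Lagrange inner_commute)
qed

section \<open>The Frenet equations\<close>

text \<open>The first differentiability assumption gives \<open>T'\<close> and hence \<open>N\<close>, the second makes \<open>N\<close>
  differentiable.\<close>

locale frenet_curve =
  fixes I :: "real set" and f :: "real \<Rightarrow> real^3"
  assumes open_I: "open I"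
    and diff_velocity: "\<And>s. s \<in> I \<Longrightarrow> velocity f differentiable (at s)"
    and diff_acceleration: "\<And>s. s \<in> I \<Longrightarrow> velocity (velocity f) differentiable (at s)"
    and curvature_nz: "\<And>s. s \<in> I \<Longrightarrow> curvature f s \<noteq> 0"
begin

abbreviation "T \<equiv> unit_tangent f"
abbreviation "N \<equiv> unit_normal f"
abbreviation "B \<equiv> unit_binormal f"
abbreviation "v \<equiv> speed f"
abbreviation "k \<equiv> curvature f"
abbreviation "t \<equiv> torsion f"

lemma speed_pos: "s \<in> I \<Longrightarrow> v s > 0"
  using curvature_nz[of s] by (auto simp: curvature_def speed_def)

lemma curvature_pos: "s \<in> I \<Longrightarrow> k s > 0"
  using curvature_nz[of s] by (simp add: curvature_def speed_def less_le)

lemma velocity_tangent_nz: "s \<in> I \<Longrightarrow> velocity T s \<noteq> 0"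
  using curvature_nz[of s] by (auto simp: curvature_def)

text \<open>A closed formula for the derivative of \<open>T\<close> is the means to differentiate it once more.\<close>

lemma has_derivative_tangent_explicit:
  assumes "s \<in> I"
  shows "(T has_vector_derivative
     (inverse (norm (velocity f s)) *\<^sub>R velocity (velocity f) s
      - ((velocity f s \<bullet> velocity (velocity f) s) / norm (velocity f s) ^ 3) *\<^sub>R velocity f s)) (at s)"
proof -
  have nz: "velocity f s \<noteq> 0" using speed_pos[OF assms] by (auto simp: speed_def)
  note V = has_vector_derivative_velocity[OF diff_velocity[OF assms]]
  have "((\<lambda>x. inverse (norm (velocity f x)) *\<^sub>R velocity f x) has_vector_derivative
     (inverse (norm (velocity f s)) *\<^sub>R velocity (velocity f) s
      - ((velocity f s \<bullet> velocity (velocity f) s) / norm (velocity f s) ^ 3) *\<^sub>R velocity f s)) (at s)"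
    using has_vector_derivative_scaleR[OF
        DERIV_inverse'[OF has_real_derivative_norm[OF V nz]] V] nz
    by (simp add: power3_eq_cube field_simps)
  then show ?thesis unfolding unit_tangent_def[abs_def] speed_def .
qed

lemma has_derivative_tangent:
  assumes "s \<in> I" shows "(T has_vector_derivative (v s * k s) *\<^sub>R N s) (at s)"
proof -
  have "(v s * k s) *\<^sub>R N s = velocity T s"
    using speed_pos[OF assms] velocity_tangent_nz[OF assms]
    by (simp add: curvature_def unit_normal_def)
  then show ?thesis
    using has_derivative_tangent_explicit[OF assms]
      velocity_eqI[OF has_derivative_tangent_explicit[OF assms]] by simp
qed

lemma normal_differentiable:
  assumes "s \<in> I" shows "N differentiable (at s)"
proof -
  have nz: "velocity f s \<noteq> 0" using speed_pos[OF assms] by (auto simp: speed_def)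
  define D where "D = (\<lambda>x. (inverse (norm (velocity f x)) *\<^sub>R velocity (velocity f) x
      - ((velocity f x \<bullet> velocity (velocity f) x) / norm (velocity f x) ^ 3) *\<^sub>R velocity f x))"
  note V = has_vector_derivative_velocity[OF diff_velocity[OF assms]]
  have "(\<lambda>x. norm (velocity f x)) differentiable (at s)"
    using has_real_derivative_norm[OF V nz] real_differentiable_def by blast
  moreover have "(\<lambda>x. velocity f x \<bullet> velocity (velocity f) x) differentiable (at s)"
    using has_real_derivative_inner[OF V has_vector_derivative_velocity[OF diff_acceleration[OF assms]]]
      real_differentiable_def by blast
  ultimately have "D differentiable (at s)"
    unfolding D_def using nz diff_velocity[OF assms] diff_acceleration[OF assms] by (auto intro!: derivative_intros)
  then have diffT': "velocity T differentiable (at s)"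
    by (rule differentiable_cong_open[OF open_I assms, rotated])
       (use has_derivative_tangent_explicit in \<open>auto simp: D_def intro: velocity_eqI\<close>)
  then have "(\<lambda>x. norm (velocity T x)) differentiable (at s)"
    using has_real_derivative_norm[OF has_vector_derivative_velocity[OF diffT']
        velocity_tangent_nz[OF assms]] real_differentiable_def by blast
  with diffT' show ?thesis
    unfolding unit_normal_def[abs_def]
    using velocity_tangent_nz[OF assms] by (auto intro!: derivative_intros)
qed

lemma tangent_unit: "s \<in> I \<Longrightarrow> T s \<bullet> T s = 1"
  using speed_pos[of s] by (simp add: unit_tangent_def speed_def dot_square_norm power2_eq_square)

lemma normal_unit: "s \<in> I \<Longrightarrow> N s \<bullet> N s = 1"
  using velocity_tangent_nz[of s] by (simp add: unit_normal_def dot_square_norm power2_eq_square)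

lemma derivative_zero_if_constant:
  fixes g :: "real \<Rightarrow> real"
  assumes "(g has_real_derivative D) (at s)" "s \<in> I" "\<And>x. x \<in> I \<Longrightarrow> g x = c"
  shows "D = 0"
proof -
  have "((\<lambda>_. c) has_real_derivative D) (at s)"
    using has_field_derivative_transform_within_open[OF assms(1) open_I assms(2)] assms(3) by auto
  then show ?thesis using DERIV_unique DERIV_const by blast
qed

lemma tangent_normal:
  assumes "s \<in> I" shows "T s \<bullet> N s = 0"
proof -
  note T' = has_derivative_tangent[OF assms]
  have "T s \<bullet> ((v s * k s) *\<^sub>R N s) + ((v s * k s) *\<^sub>R N s) \<bullet> T s = 0"
    by (rule derivative_zero_if_constant[OF has_real_derivative_inner[OF T' T'] assms])
       (rule tangent_unit)
  then show ?thesis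
    using speed_pos[OF assms] curvature_pos[OF assms] by (simp add: inner_commute)
qed

lemma binormal_unit: "s \<in> I \<Longrightarrow> B s \<bullet> B s = 1"
  using norm_cross_dot[of "T s" "N s"] tangent_unit[of s] normal_unit[of s] tangent_normal[of s]
  by (simp add: unit_binormal_def dot_square_norm power_mult_distrib)

text \<open>As \<open>T'\<close> is parallel to \<open>N\<close>, only \<open>T \<times> N'\<close> survives in \<open>(T \<times> N)'\<close>. It is orthogonal to
  \<open>T\<close>, and to \<open>B\<close> since \<open>B\<close> has constant length; what remains is its component along \<open>N\<close>, which
  is the torsion by definition.\<close>

lemma has_derivative_binormal:
  assumes "s \<in> I" shows "(B has_vector_derivative - ((v s * t s) *\<^sub>R N s)) (at s)"
proof -
  have "(B has_vector_derivative
      (cross3 (T s) (velocity N s) + cross3 ((v s * k s) *\<^sub>R N s) (N s))) (at s)"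
    unfolding unit_binormal_def[abs_def]
    by (rule bounded_bilinear.has_vector_derivative[OF bounded_bilinear_cross3
        has_derivative_tangent[OF assms]
        has_vector_derivative_velocity[OF normal_differentiable[OF assms]]])
  then have B': "(B has_vector_derivative cross3 (T s) (velocity N s)) (at s)"
    by (simp add: cross_mult_left)
  let ?D = "cross3 (T s) (velocity N s)"
  have "B s \<bullet> ?D + ?D \<bullet> B s = 0"
    by (rule derivative_zero_if_constant[OF has_real_derivative_inner[OF B' B'] assms])
       (rule binormal_unit)
  then have "?D \<bullet> cross3 (T s) (N s) = 0"
    by (simp add: inner_commute unit_binormal_def)
  moreover have "?D \<bullet> T s = 0" by (simp add: dot_cross_self inner_commute)
  ultimately have "?D = (?D \<bullet> N s) *\<^sub>R N s"
    using orthogonal_to_frame_parallel normal_unit tangent_unit tangent_normal assms by blast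
  moreover have "?D \<bullet> N s = - (v s * t s)"
    using velocity_eqI[OF B'] speed_pos[OF assms] by (simp add: torsion_def)
  ultimately show ?thesis using B' by (metis scaleR_minus_left)
qed

text \<open>The other two equations already determine the derivative of \<open>N = B \<times> T\<close>.\<close>

lemma has_derivative_normal:
  assumes "s \<in> I"
  shows "(N has_vector_derivative (v s * t s) *\<^sub>R B s - (v s * k s) *\<^sub>R T s) (at s)"
proof -
  have eqs: "cross3 (B x) (T x) = N x \<and> cross3 (N x) (T x) = - B x \<and> cross3 (B x) (N x) = - T x"
    if "x \<in> I" for x
    using orthonormal_cross[OF tangent_unit[OF that] normal_unit[OF that] tangent_normal[OF that]]
    by (simp add: unit_binormal_def)
  have "((\<lambda>x. cross3 (B x) (T x)) has_vector_derivative
      (cross3 (B s) ((v s * k s) *\<^sub>R N s) + cross3 (- ((v s * t s) *\<^sub>R N s)) (T s))) (at s)"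
    by (rule bounded_bilinear.has_vector_derivative[OF bounded_bilinear_cross3
        has_derivative_binormal[OF assms] has_derivative_tangent[OF assms]])
  then have "((\<lambda>x. cross3 (B x) (T x)) has_vector_derivative
      (v s * t s) *\<^sub>R B s - (v s * k s) *\<^sub>R T s) (at s)"
    using eqs[OF assms] by (simp add: cross_mult_left cross_mult_right)
  then show ?thesis
    by (rule has_vector_derivative_transform_within_open[OF _ open_I assms]) (use eqs in auto)
qed

section \<open>Binormal circles and generalized helices\<close>

lemma inner_frame_derivatives:
  assumes "s \<in> I"
  shows "((\<lambda>x. n \<bullet> T x) has_real_derivative v s * k s * (n \<bullet> N s)) (at s)"
    and "((\<lambda>x. n \<bullet> N x) has_real_derivative v s * (t s * (n \<bullet> B s) - k s * (n \<bullet> T s))) (at s)"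
    and "((\<lambda>x. n \<bullet> B x) has_real_derivative - (v s * t s * (n \<bullet> N s))) (at s)"
  using has_real_derivative_inner[OF has_vector_derivative_const has_derivative_tangent[OF assms]]
    has_real_derivative_inner[OF has_vector_derivative_const has_derivative_normal[OF assms]]
    has_real_derivative_inner[OF has_vector_derivative_const has_derivative_binormal[OF assms]]
  by (simp_all add: inner_diff_right algebra_simps)

text \<open>The coordinates of the plane normal \<open>n\<close> in the moving frame are constant, namely
  \<open>(a, 0, d)\<close>; the Frenet equation for \<open>N\<close> turns this into the ratio \<open>t / k = a / d\<close>.\<close>

lemma helix_if_binormal_circle:
  assumes "is_interval I" "\<And>s. s \<in> I \<Longrightarrow> t s \<noteq> 0" "circle_on_unit_sphere I B"
  shows "generalized_helix_on I f"
proof -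
  obtain n d where n: "n \<noteq> 0" and sub: "B ` I \<subseteq> sphere 0 1 \<inter> {x. n \<bullet> x = d}"
    using assms(3) unfolding circle_on_unit_sphere_def by blast
  have d: "n \<bullet> B s = d" if "s \<in> I" for s
    using sub that by auto
  have N0: "n \<bullet> N s = 0" if "s \<in> I" for s
  proof -
    have "- (v s * t s * (n \<bullet> N s)) = 0"
      by (rule derivative_zero_if_constant[OF inner_frame_derivatives(3)[OF that] that]) (rule d)
    then show ?thesis using speed_pos[OF that] assms(2)[OF that] by simp
  qed
  have "((\<lambda>s. n \<bullet> T s) has_vector_derivative 0) (at s)" if "s \<in> I" for s
    using inner_frame_derivatives(1)[OF that, of n] N0[OF that]
    by (simp add: has_real_derivative_iff_has_vector_derivative)
  then have "(\<lambda>s. n \<bullet> T s) constant_on I"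
    by (rule constant_on_if_derivative_zero[OF assms(1)])
  then obtain a where a: "\<And>s. s \<in> I \<Longrightarrow> n \<bullet> T s = a"
    unfolding constant_on_def by blast
  have rel: "t s * d = k s * a" if "s \<in> I" for s
  proof -
    have "v s * (t s * (n \<bullet> B s) - k s * (n \<bullet> T s)) = 0"
      by (rule derivative_zero_if_constant[OF inner_frame_derivatives(2)[OF that] that]) (rule N0)
    then show ?thesis using speed_pos[OF that] a[OF that] d[OF that] by simp
  qed
  have ratio: "t s / k s = a / d" if "s \<in> I" for s
  proof -
    \<comment> \<open>A great circle would force \<open>n\<close> to be orthogonal to the whole frame.\<close>
    have "d \<noteq> 0"
    proof
      assume "d = 0"
      then have "a = 0" using rel[OF that] curvature_pos[OF that] by auto
      with \<open>d = 0\<close> have "n = (n \<bullet> N s) *\<^sub>R N s"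
        using a[OF that] d[OF that] tangent_unit[OF that] normal_unit[OF that] tangent_normal[OF that]
        by (intro orthogonal_to_frame_parallel[of n "T s"]) (auto simp: unit_binormal_def)
      then show False using N0[OF that] n by simp
    qed
    then show ?thesis using rel[OF that] curvature_pos[OF that] by (simp add: field_simps)
  qed
  then show ?thesis
    unfolding generalized_helix_on_def constant_on_def using curvature_pos by blast
qed

lemma binormal_circle_if_helix:
  assumes "is_interval I" "generalized_helix_on I f"
  shows "circle_on_unit_sphere I B"
proof (cases "I = {}")
  case True
  have "(1::real^3) \<noteq> 0" by simp
  with True show ?thesis unfolding circle_on_unit_sphere_def by blast
next
  case False
  then obtain s0 where s0: "s0 \<in> I" by blast
  obtain m where m: "\<And>s. s \<in> I \<Longrightarrow> t s / k s = m"
    using assms(2) unfolding generalized_helix_on_def constant_on_def by blast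
  have t: "t s = m * k s" if "s \<in> I" for s
    using m[OF that] curvature_pos[OF that] by (simp add: divide_eq_eq)
  \<comment> \<open>In every Frenet frame a plane normal has to have the coordinates \<open>(m, 0, 1)\<close> up to scale.\<close>
  define W where "W = (\<lambda>s. m *\<^sub>R T s + B s)"
  define n where "n = W s0"
  have BT: "B s \<bullet> T s = 0" for s
    by (simp add: unit_binormal_def dot_cross_self inner_commute)
  have W': "(W has_vector_derivative 0) (at s)" if "s \<in> I" for s
    unfolding W_def
    by (rule derivative_eq_intros has_derivative_tangent has_derivative_binormal that refl)+
       (simp add: t[OF that])
  have Wn: "W s = n" if "s \<in> I" for s
  proof -
    obtain w where w: "\<And>s. s \<in> I \<Longrightarrow> W s = w"
      using constant_on_if_derivative_zero[OF assms(1) W'] unfolding constant_on_def by blast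
    show ?thesis using w[OF that] w[OF s0] by (simp add: n_def)
  qed
  have "n \<bullet> B s = 1" if "s \<in> I" for s
    using binormal_unit[OF that] BT[of s]
    by (simp add: W_def inner_add_right inner_commute flip: Wn[OF that])
  moreover have "norm (B s) = 1" if "s \<in> I" for s
    using binormal_unit[OF that] by (simp add: norm_eq_1)
  ultimately have "B ` I \<subseteq> sphere 0 1 \<inter> {x. n \<bullet> x = 1}" and "n \<bullet> B s0 = 1"
    using s0 by auto
  then have "n \<noteq> 0" by auto
  with \<open>B ` I \<subseteq> _\<close> show ?thesis unfolding circle_on_unit_sphere_def by blast
qed

end

section \<open>Involutes\<close>

text \<open>The two terms \<open>\<gamma>'\<close> in the derivative of \<open>\<gamma> + (c - s) \<gamma>'\<close> cancel, which leaves
  \<open>(c - s) \<gamma>''\<close>. Where the curvature of the involute is zero, its speed or the derivative of its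
  unit tangent is zero. The torsion is then zero as well: in the first case by the convention
  \<open>x / 0 = 0\<close>, in the second because the unit normal is the zero vector.\<close>

lemma involute_frenet_curve:
  assumes "open I" "smooth_curve_on I \<gamma>"
    and "\<And>s. s \<in> I \<Longrightarrow> speed \<gamma> s = 1"
    and "\<And>s. s \<in> I \<Longrightarrow> torsion (involute c \<gamma>) s \<noteq> 0"
  shows "frenet_curve I (involute c \<gamma>)"
proof -
  let ?f = "involute c \<gamma>"
  define V where "V n = (velocity ^^ n) \<gamma>" for n
  have V': "(V n has_vector_derivative V (Suc n) s) (at s)" if "s \<in> I" for n s
    using assms(2) that has_vector_derivative_velocity
    unfolding smooth_curve_on_def V_def by auto
  have feq: "?f s = V 0 s + (c - s) *\<^sub>R V 1 s" if "s \<in> I" for s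
    using assms(3)[OF that] by (simp add: involute_def unit_tangent_def V_def)
  have f': "(?f has_vector_derivative (c - s) *\<^sub>R V 2 s) (at s)" if "s \<in> I" for s
  proof -
    have "((\<lambda>s. V 0 s + (c - s) *\<^sub>R V 1 s) has_vector_derivative (c - s) *\<^sub>R V 2 s) (at s)"
      by (rule derivative_eq_intros V'[OF that] refl)+ (simp add: numeral_2_eq_2)
    then show ?thesis
      by (rule has_vector_derivative_transform_within_open[OF _ assms(1) that]) (simp add: feq)
  qed
  have f'': "(velocity ?f has_vector_derivative (c - s) *\<^sub>R V 3 s - V 2 s) (at s)" if "s \<in> I" for s
  proof -
    have "((\<lambda>s. (c - s) *\<^sub>R V 2 s) has_vector_derivative (c - s) *\<^sub>R V 3 s - V 2 s) (at s)"
      by (rule derivative_eq_intros V'[OF that] refl)+ (simp add: numeral_3_eq_3 numeral_2_eq_2)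
    then show ?thesis
      by (rule has_vector_derivative_transform_within_open[OF _ assms(1) that])
         (simp add: velocity_eqI[OF f'])
  qed
  have f''': "velocity (velocity ?f) differentiable (at s)" if "s \<in> I" for s
  proof (rule differentiable_cong_open[OF assms(1) that])
    show "velocity (velocity ?f) x = (c - x) *\<^sub>R V 3 x - V 2 x" if "x \<in> I" for x
      using velocity_eqI[OF f''[OF that]] .
    show "(\<lambda>x. (c - x) *\<^sub>R V 3 x - V 2 x) differentiable (at s)"
      using V'[OF that] differentiableI_vector by (auto intro!: derivative_intros)
  qed
  have "curvature ?f s \<noteq> 0" if "s \<in> I" for s
    using assms(4)[OF that]
    by (auto simp: torsion_def curvature_def unit_normal_def)
  then show ?thesis
    using assms(1) f' f'' f''' differentiableI_vector by unfold_locales blast+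
qed

theorem theorem11:
  fixes \<gamma> :: "real \<Rightarrow> real^3" and I :: "real set" and c :: real
  assumes "open I" and "is_interval I"
    and "smooth_curve_on I \<gamma>"
    and "\<And>s. s \<in> I \<Longrightarrow> speed \<gamma> s = 1"
    and "\<And>s. s \<in> I \<Longrightarrow> curvature \<gamma> s \<noteq> 0"
    and "\<And>s. s \<in> I \<Longrightarrow> c - s > 0"
    and "\<And>s. s \<in> I \<Longrightarrow> torsion (involute c \<gamma>) s \<noteq> 0"
  shows "circle_on_unit_sphere I (unit_binormal (involute c \<gamma>)) \<longleftrightarrow>
         generalized_helix_on I (involute c \<gamma>)"
proof -
  interpret frenet_curve I "involute c \<gamma>"
    using involute_frenet_curve assms(1,3,4,7) by blast
  show ?thesis
    using helix_if_binormal_circle binormal_circle_if_helix assms(2,7) by blast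
qed

end
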